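(* For every $D>0$ there is a constant $K$ such that the following holds. Let $k=k(n)$ be a positive integer with $k<D\log n$ and $k\mid n$, let $m=n/k$, and let $v_1,\dots,v_m$ be $m$ given distinct vertices of $[n]$. Then, with probability tending to $1$ as $n\to\infty$, the random graph $\mathcal{G}(n,K\frac{\log n}{n})$ contains $m$ pairwise vertex-disjoint paths, each on exactly $k$ vertices, such that for each $i\in[m]$ the $i$-th path has $v_i$ as an endpoint.
   Context: $\mathcal{G}(n,p)$ denotes the binomial random graph on vertex set $[n]=\{1,\dots,n\}$ in which each possible edge is present independently with probability $p$. $\log$ denotes the natural logarithm. *)

theory Defs
  imports "HOL-Probability.Probability"
begin

definition all_edges :: "nat \<Rightarrow> nat set set" where
  "all_edges n = {e. \<exists>a b. a \<in> {1..n} \<and> b \<in> {1..n} \<and> a \<noteq> b \<and> e = {a, b}}"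

text \<open>The binomial random graph G(n,p), as a distribution on edge sets.
  (bernoulli_pmf clamps p to [0,1].)\<close>
definition Gnp :: "nat \<Rightarrow> real \<Rightarrow> nat set set pmf" where
  "Gnp n p = map_pmf (\<lambda>f. {e \<in> all_edges n. f e})
              (Pi_pmf (all_edges n) False (\<lambda>_. bernoulli_pmf p))"

definition is_path :: "nat \<Rightarrow> nat set set \<Rightarrow> nat list \<Rightarrow> bool" where
  "is_path n E xs \<longleftrightarrow> xs \<noteq> [] \<and> distinct xs \<and> set xs \<subseteq> {1..n} \<and>
     (\<forall>j. Suc j < length xs \<longrightarrow> {xs ! j, xs ! Suc j} \<in> E)"

end

theory Submission
  imports Defs "HOL-Real_Asymp.Real_Asymp"
begin

text \<open>
  Place the non-root vertices uniformly at random on the free positions of the paths. A set of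
  \<^term>\<open>s\<close> edges is contained in the resulting path system with probability at most
  \<^term>\<open>(C / n) ^ s\<close>, that is, the path systems are \<^term>\<open>C / n\<close>-spread. The theorem of Frankston,
  Kahn, Narayanan and Park on spread families then yields a path system in a random edge set of
  density \<^term>\<open>C' * ln n / n\<close>. For that theorem the random set is exposed in rounds of density
  \<^term>\<open>64 * q\<close>. After a round, replace each member by the smallest uncovered part of a member
  inside its union with the exposed set; all but a tiny fraction of these parts have at most half
  of the previous maximal size. Once the sizes are below \<^term>\<open>sqrt (ln n)\<close>, one round of
  density \<^term>\<open>q * ln n\<close> covers almost all of what is left.
\<close>

section \<open>Biased random subsets\<close>

text \<open>Expectation of \<open>f\<close> over the random subset of a finite \<open>X\<close> that
  keeps each element independently with probability \<open>p\<close>. As a finite sum it is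
  polynomial in \<open>p\<close>, and identities follow by induction on \<open>X\<close>.\<close>

definition biased_sum :: "real \<Rightarrow> 'a set \<Rightarrow> ('a set \<Rightarrow> real) \<Rightarrow> real" where
  "biased_sum p X f = (\<Sum>W\<in>Pow X. p ^ card W * (1 - p) ^ card (X - W) * f W)"

lemma biased_sum_mono:
  assumes "0 \<le> p" "p \<le> 1" "\<And>W. W \<subseteq> X \<Longrightarrow> f W \<le> g W"
  shows "biased_sum p X f \<le> biased_sum p X g"
  unfolding biased_sum_def using assms by (intro sum_mono mult_left_mono) auto

lemma biased_sum_add: "biased_sum p X (\<lambda>W. f W + g W) = biased_sum p X f + biased_sum p X g"
  by (simp add: biased_sum_def distrib_left sum.distrib)

lemma biased_sum_cmult: "biased_sum p X (\<lambda>W. c * f W) = c * biased_sum p X f"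
  by (simp add: biased_sum_def sum_distrib_left algebra_simps)

lemma biased_sum_empty [simp]: "biased_sum p {} f = f {}"
  by (simp add: biased_sum_def)

text \<open>Conditions on whether \<open>x\<close> is kept, which matches the splitting of
  \<open>Pow (insert x X)\<close>.\<close>

lemma biased_sum_insert:
  assumes "finite X" "x \<notin> X"
  shows "biased_sum p (insert x X) f =
    p * biased_sum p X (\<lambda>W. f (insert x W)) + (1 - p) * biased_sum p X f"
proof -
  have "biased_sum p (insert x X) f =
      (\<Sum>W\<in>Pow X. p ^ card W * (1 - p) ^ card (insert x X - W) * f W) +
      (\<Sum>W\<in>insert x ` Pow X. p ^ card W * (1 - p) ^ card (insert x X - W) * f W)"
    unfolding biased_sum_def Pow_insert
    using assms by (intro sum.union_disjoint) auto
  also have "(\<Sum>W\<in>Pow X. p ^ card W * (1 - p) ^ card (insert x X - W) * f W) =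
      (1 - p) * biased_sum p X f"
    unfolding biased_sum_def sum_distrib_left
  proof (intro sum.cong refl)
    fix W assume W: "W \<in> Pow X"
    then have "insert x X - W = insert x (X - W)" using assms by auto
    then have "card (insert x X - W) = Suc (card (X - W))" using assms by auto
    then show "p ^ card W * (1 - p) ^ card (insert x X - W) * f W =
        (1 - p) * (p ^ card W * (1 - p) ^ card (X - W) * f W)"
      by simp
  qed
  also have "(\<Sum>W\<in>insert x ` Pow X. p ^ card W * (1 - p) ^ card (insert x X - W) * f W) =
      p * biased_sum p X (\<lambda>W. f (insert x W))"
    unfolding biased_sum_def sum_distrib_left
  proof (subst sum.reindex)
    show "inj_on (insert x) (Pow X)"
      using assms(2) by (auto simp: inj_on_def)
    show "sum ((\<lambda>W. p ^ card W * (1 - p) ^ card (insert x X - W) * f W) \<circ> insert x) (Pow X) =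
        (\<Sum>W\<in>Pow X. p * (p ^ card W * (1 - p) ^ card (X - W) * f (insert x W)))"
    proof (intro sum.cong refl)
      fix W assume W: "W \<in> Pow X"
      then have "insert x X - insert x W = X - W" "card (insert x W) = Suc (card W)"
        using assms finite_subset[of W X] by (auto simp: card_insert_if)
      then show "((\<lambda>W. p ^ card W * (1 - p) ^ card (insert x X - W) * f W) \<circ> insert x) W =
          p * (p ^ card W * (1 - p) ^ card (X - W) * f (insert x W))"
        by simp
    qed
  qed
  finally show ?thesis by simp
qed

lemma biased_sum_const: "finite X \<Longrightarrow> biased_sum p X (\<lambda>_. c) = c"
  by (induction X rule: finite_induct) (auto simp: biased_sum_insert algebra_simps)

text \<open>An element avoids two independent random subsets with probability
  \<open>(1 - a) * (1 - b)\<close>, so their union has density \<open>a + b - a * b\<close>. This is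
  the tool for exposing a random set in rounds.\<close>

lemma biased_sum_union:
  assumes "finite X"
  shows "biased_sum a X (\<lambda>V. biased_sum b X (\<lambda>W. f (V \<union> W))) = biased_sum (a + b - a * b) X f"
  using assms
proof (induction X arbitrary: f rule: finite_induct)
  case (insert x X)
  then show ?case
    by (simp add: biased_sum_insert biased_sum_add biased_sum_cmult insert.IH
        insert.IH[of "\<lambda>W. f (insert x W)", simplified]) (simp add: algebra_simps)
qed simp

section \<open>The spread lemma\<close>

text \<open>The family is indexed rather than a set of sets: different indices may acquire the same
  residual later and must still be counted separately.\<close>

definition miss_prob :: "real \<Rightarrow> 'a set \<Rightarrow> 'i set \<Rightarrow> ('i \<Rightarrow> 'a set) \<Rightarrow> real" where
  "miss_prob p X I A = biased_sum p X (\<lambda>W. of_bool (\<forall>i\<in>I. \<not> A i \<subseteq> W))"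

lemma miss_prob_le_1:
  assumes "finite X" "0 \<le> p" "p \<le> 1"
  shows "miss_prob p X I A \<le> 1"
proof -
  have "miss_prob p X I A \<le> biased_sum p X (\<lambda>_. 1)"
    unfolding miss_prob_def using assms by (intro biased_sum_mono) auto
  then show ?thesis using assms by (simp add: biased_sum_const)
qed

text \<open>Sprinkling: a set of density \<open>p'\<close> arises from one of density
  \<open>p\<close> by adding an independent one of density \<open>b\<close>, and added elements
  cannot destroy the containment of a member.\<close>

lemma miss_prob_antimono:
  assumes "finite X" "0 \<le> p" "p \<le> p'" "p' \<le> 1"
  shows "miss_prob p' X I A \<le> miss_prob p X I A"
proof (cases "p = 1")
  case False
  define b where "b = (p' - p) / (1 - p)"
  have "b * (1 - p) = p' - p" using False by (simp add: b_def)
  then have p': "p' = p + b - p * b" by (simp add: algebra_simps)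
  have b: "0 \<le> b" "b \<le> 1" using assms False by (auto simp: b_def divide_le_eq_1)
  have "miss_prob p' X I A =
      biased_sum p X (\<lambda>V. biased_sum b X (\<lambda>W. of_bool (\<forall>i\<in>I. \<not> A i \<subseteq> V \<union> W)))"
    unfolding miss_prob_def p'
    by (rule biased_sum_union[OF assms(1), symmetric])
  also have "\<dots> \<le> biased_sum p X (\<lambda>V. biased_sum b X (\<lambda>W. of_bool (\<forall>i\<in>I. \<not> A i \<subseteq> V)))"
    using assms b by (intro biased_sum_mono) auto
  finally show ?thesis
    using assms(1) by (simp add: biased_sum_const miss_prob_def)
qed (use assms in auto)

text \<open>The normalised notion has \<open>M = card I\<close>. Keeping \<open>M\<close> separate
  lets a subfamily inherit the bound unchanged when indices are discarded.\<close>

definition spread :: "real \<Rightarrow> real \<Rightarrow> 'a set \<Rightarrow> 'i set \<Rightarrow> ('i \<Rightarrow> 'a set) \<Rightarrow> bool" where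
  "spread q M X I A \<longleftrightarrow> (\<forall>U\<subseteq>X. real (card {i \<in> I. U \<subseteq> A i}) \<le> q ^ card U * M)"

text \<open>The index \<open>j\<close> may differ from \<open>i\<close>. For \<open>i\<close> in
  \<open>I\<close> the choice \<open>j = i\<close> is admissible, so the minimum is
  attained.\<close>

definition residual :: "('i \<Rightarrow> 'a set) \<Rightarrow> 'i set \<Rightarrow> 'a set \<Rightarrow> 'i \<Rightarrow> 'a set" where
  "residual A I W i = (ARG_MIN card S. \<exists>j\<in>I. S = A j - W \<and> A j \<subseteq> A i \<union> W)"

lemma residual_eq:
  assumes "i \<in> I"
  obtains j where "j \<in> I" "residual A I W i = A j - W" "A j \<subseteq> A i \<union> W"
  using arg_min_natI[of "\<lambda>S. \<exists>j\<in>I. S = A j - W \<and> A j \<subseteq> A i \<union> W" "A i - W" card] assms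
  unfolding residual_def by blast

lemma residual_le:
  assumes "j \<in> I" "A j \<subseteq> A i \<union> W"
  shows "card (residual A I W i) \<le> card (A j - W)"
  unfolding residual_def by (rule arg_min_nat_le) (use assms in blast)

lemma residual_subset: "i \<in> I \<Longrightarrow> residual A I W i \<subseteq> A i"
  by (rule residual_eq[of i I A W]) auto

text \<open>Any member inside \<^term>\<open>W \<union> residual A I W i\<close> contains the residual, by minimality. So the
  residual can be recovered from the union at the cost of one subset of a single member, while
  spreadness bounds the number of compatible \<^term>\<open>i\<close>.\<close>

lemma residual_subset_member:
  assumes "i \<in> I" "j \<in> I" "finite (A i)" "A j \<subseteq> W \<union> residual A I W i"
  shows "residual A I W i \<subseteq> A j"
proof -
  have "A j - W \<subseteq> residual A I W i" using assms(4) by blast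
  moreover have "card (residual A I W i) \<le> card (A j - W)"
    using assms residual_subset[of i I A W] by (intro residual_le) auto
  moreover have "finite (residual A I W i)"
    using assms residual_subset finite_subset by metis
  ultimately have "A j - W = residual A I W i"
    by (intro card_seteq) auto
  then show ?thesis by blast
qed

section \<open>Counting indices with large residuals\<close>

lemma sum_card_subsets_le:
  fixes h :: "nat \<Rightarrow> real"
  assumes "finite B" "card B \<le> r" "\<And>t. 0 \<le> h t"
  shows "(\<Sum>T\<in>{T\<in>Pow B. s < card T}. h (card T)) \<le> (\<Sum>t\<in>{s<..r}. real (r choose t) * h t)"
proof -
  have "(\<Sum>T\<in>{T\<in>Pow B. s < card T}. h (card T)) =
      (\<Sum>t\<in>{s<..r}. \<Sum>T\<in>{T. T \<in> {T\<in>Pow B. s < card T} \<and> card T = t}. h (card T))"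
    using assms(1,2)
    by (intro sum.group[symmetric]) (auto dest: card_mono[OF assms(1)] intro: order_trans)
  also have "\<dots> \<le> (\<Sum>t\<in>{s<..r}. real (r choose t) * h t)"
  proof (intro sum_mono)
    fix t assume t: "t \<in> {s<..r}"
    then have "{T. T \<in> {T\<in>Pow B. s < card T} \<and> card T = t} = {T. T \<subseteq> B \<and> card T = t}"
      by auto
    then have "(\<Sum>T\<in>{T. T \<in> {T\<in>Pow B. s < card T} \<and> card T = t}. h (card T)) =
        real (card B choose t) * h t"
      using n_subsets[OF assms(1), of t] by simp
    also have "\<dots> \<le> real (r choose t) * h t"
      using assms by (intro mult_right_mono) (auto intro: binomial_right_mono)
    finally show "(\<Sum>T\<in>{T. T \<in> {T\<in>Pow B. s < card T} \<and> card T = t}. h (card T)) \<le>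
        real (r choose t) * h t" .
  qed
  finally show ?thesis .
qed

text \<open>Encode a pair \<open>(W, i)\<close> with residual \<open>T\<close> as
  \<open>(Z, T, i)\<close> where \<open>Z = W \<union> T\<close>; then \<open>W = Z - T\<close>.
  Passing from \<open>W\<close> to \<open>Z\<close> costs a factor of at most
  \<open>1 / p ^ card T\<close>. For fixed \<open>Z\<close> there are at most
  \<open>r choose t\<close> sets \<open>T\<close> of size \<open>t\<close>, all inside one member,
  and at most \<open>q ^ t * M\<close> indices \<open>i\<close> with
  \<open>T \<subseteq> A i\<close>.\<close>

lemma expected_large_residuals:
  assumes fin: "finite X" "finite I"
    and A: "\<And>i. i \<in> I \<Longrightarrow> A i \<subseteq> X" "\<And>i. i \<in> I \<Longrightarrow> card (A i) \<le> r"
    and spr: "spread q M X I A"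
    and p: "0 < p" "p \<le> 1" and q: "0 \<le> q" and M: "0 \<le> M"
  shows "biased_sum p X (\<lambda>W. real (card {i \<in> I. s < card (residual A I W i)}))
    \<le> M * (\<Sum>t\<in>{s<..r}. real (r choose t) * (q / p) ^ t)"
proof -
  define w where "w W = p ^ card W * (1 - p) ^ card (X - W)" for W
  define G where "G = {Z \<in> Pow X. \<exists>j\<in>I. A j \<subseteq> Z}"
  \<comment> \<open>The chosen member depends on \<open>Z\<close> alone; otherwise \<open>T\<close>
    would not range over the subsets of a single set of size at most \<open>r\<close>.\<close>
  define c where "c Z = (SOME j. j \<in> I \<and> A j \<subseteq> Z)" for Z
  define \<sigma> where "\<sigma> = (\<Sum>t\<in>{s<..r}. real (r choose t) * (q / p) ^ t)"
  have w0: "0 \<le> w W" for W using p by (simp add: w_def)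
  have cZ: "c Z \<in> I" "A (c Z) \<subseteq> Z" if "Z \<in> G" for Z
    using that someI_ex[of "\<lambda>j. j \<in> I \<and> A j \<subseteq> Z"] by (auto simp: G_def c_def)
  have finA: "finite (A i)" if "i \<in> I" for i using A(1) that fin(1) finite_subset by blast
  have finG: "finite G" using fin by (simp add: G_def)
  have \<sigma>0: "0 \<le> \<sigma>" using p q by (auto simp: \<sigma>_def intro!: sum_nonneg)
  let ?S = "\<lambda>W. {i \<in> I. s < card (residual A I W i)}"
  let ?T = "\<lambda>Z. {T \<in> Pow (A (c Z)). s < card T}"
  let ?D = "SIGMA Z:G. SIGMA T:?T Z. {i \<in> I. T \<subseteq> A i}"
  have finT: "finite (?T Z)" if "Z \<in> G" for Z using finA cZ that by auto
  have finD: "finite ?D"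
    using finG finT fin(2) by (intro finite_SigmaI) auto
  have "biased_sum p X (\<lambda>W. real (card (?S W))) = (\<Sum>W\<in>Pow X. \<Sum>i\<in>?S W. w W)"
    by (simp add: biased_sum_def w_def mult.commute)
  also have "\<dots> = (\<Sum>(W, i)\<in>(SIGMA W:Pow X. ?S W). w W)"
    using fin by (subst sum.Sigma) auto
  also have "\<dots> \<le> (\<Sum>(Z, T, i)\<in>?D. w Z / p ^ card T)"
  proof (rule sum_le_included[where i = "\<lambda>(Z, T, i). (Z - T, i)"])
    show "finite (SIGMA W:Pow X. ?S W)" using fin by (intro finite_SigmaI) auto
    show "finite ?D" by (rule finD)
    show "\<forall>y\<in>?D. 0 \<le> (case y of (Z, T, i) \<Rightarrow> w Z / p ^ card T)"
      using w0 p by auto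
    show "\<forall>x\<in>(SIGMA W:Pow X. ?S W). \<exists>y\<in>?D. (case y of (Z, T, i) \<Rightarrow> (Z - T, i)) = x \<and>
        (case x of (W, i) \<Rightarrow> w W) \<le> (case y of (Z, T, i) \<Rightarrow> w Z / p ^ card T)"
    proof safe
      fix W i assume W: "W \<subseteq> X" and i: "i \<in> I" "s < card (residual A I W i)"
      define T where "T = residual A I W i"
      obtain j where j: "j \<in> I" "T = A j - W" "A j \<subseteq> A i \<union> W"
        using residual_eq[OF i(1), of A W] T_def by metis
      have TA: "T \<subseteq> A i" using residual_subset[OF i(1)] T_def by metis
      have TX: "T \<subseteq> X" using TA A(1)[OF i(1)] by blast
      have disj: "W \<inter> T = {}" using j by blast
      have G: "W \<union> T \<in> G" using W TX j by (auto simp: G_def)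
      \<comment> \<open>The chosen member lies in \<open>W \<union> T\<close>, so minimality of the
        residual forces it to contain \<open>T\<close>.\<close>
      have sub: "T \<subseteq> A (c (W \<union> T))"
        unfolding T_def using cZ[OF G] i finA
        by (intro residual_subset_member) (auto simp: T_def)
      have mem: "(W \<union> T, T, i) \<in> ?D" using G sub TA i by (auto simp: T_def)
      have fWT: "finite W" "finite T" using W TX fin finite_subset by blast+
      have "card (X - W) = card (X - (W \<union> T)) + card T"
      proof -
        have "X - W = (X - (W \<union> T)) \<union> T" using TX disj by blast
        then show ?thesis using fin fWT by (metis Diff_disjoint card_Un_disjoint
            finite_Diff inf_sup_aci(1) Int_Un_distrib Un_empty)
      qed
      moreover have "card (W \<union> T) = card W + card T"
        using fWT disj by (rule card_Un_disjoint)
      ultimately have "w W = w (W \<union> T) / p ^ card T * (1 - p) ^ card T"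
        using p by (simp add: w_def power_add)
      also have "\<dots> \<le> w (W \<union> T) / p ^ card T * 1"
        using p w0 by (intro mult_left_mono power_le_one) auto
      finally have le: "w W \<le> w (W \<union> T) / p ^ card T" by simp
      have "W \<union> T - T = W" using disj by blast
      then show "\<exists>y\<in>?D. (case y of (Z, T, i) \<Rightarrow> (Z - T, i)) = (W, i) \<and>
        w W \<le> (case y of (Z, T, i) \<Rightarrow> w Z / p ^ card T)"
        using mem le by (intro bexI[of _ "(W \<union> T, T, i)"]) auto
    qed
  qed
  also have "\<dots> = (\<Sum>Z\<in>G. \<Sum>(T, i)\<in>(SIGMA T:?T Z. {i \<in> I. T \<subseteq> A i}). w Z / p ^ card T)"
    using finG finT fin(2) by (subst sum.Sigma) (auto simp: case_prod_beta intro!: finite_SigmaI)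
  also have "\<dots> = (\<Sum>Z\<in>G. \<Sum>T\<in>?T Z. \<Sum>i\<in>{i \<in> I. T \<subseteq> A i}. w Z / p ^ card T)"
    using finT fin(2) by (intro sum.cong refl, subst sum.Sigma) auto
  also have "\<dots> \<le> (\<Sum>Z\<in>G. w Z * (M * \<sigma>))"
  proof (intro sum_mono)
    fix Z assume Z: "Z \<in> G"
    have "(\<Sum>T\<in>?T Z. \<Sum>i\<in>{i \<in> I. T \<subseteq> A i}. w Z / p ^ card T) =
        w Z * (\<Sum>T\<in>?T Z. real (card {i \<in> I. T \<subseteq> A i}) / p ^ card T)"
      by (simp add: sum_distrib_left mult.commute)
    also have "(\<Sum>T\<in>?T Z. real (card {i \<in> I. T \<subseteq> A i}) / p ^ card T) \<le>
        (\<Sum>T\<in>?T Z. M * (q / p) ^ card T)"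
    proof (intro sum_mono)
      fix T assume "T \<in> ?T Z"
      then have "T \<subseteq> X" using A(1) cZ Z by blast
      then have "real (card {i \<in> I. T \<subseteq> A i}) \<le> q ^ card T * M"
        using spr by (simp add: spread_def)
      then show "real (card {i \<in> I. T \<subseteq> A i}) / p ^ card T \<le> M * (q / p) ^ card T"
        using p by (simp add: power_divide divide_right_mono mult.commute)
    qed
    also have "\<dots> \<le> M * \<sigma>"
      unfolding \<sigma>_def sum_distrib_left[symmetric] using M p q A(2) cZ[OF Z] finA
      by (intro mult_left_mono sum_card_subsets_le) auto
    finally show "(\<Sum>T\<in>?T Z. \<Sum>i\<in>{i \<in> I. T \<subseteq> A i}. w Z / p ^ card T) \<le> w Z * (M * \<sigma>)"
      using w0 by (simp add: mult_left_mono)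
  qed
  \<comment> \<open>The weights of all subsets of \<open>X\<close> add up to 1.\<close>
  also have "\<dots> \<le> (\<Sum>Z\<in>Pow X. w Z * (M * \<sigma>))"
    using fin w0 M \<sigma>0 by (intro sum_mono2) (auto simp: G_def)
  also have "\<dots> = M * \<sigma>"
    using biased_sum_const[OF fin(1), of p "M * \<sigma>"] by (simp add: biased_sum_def w_def)
  finally show ?thesis by (simp add: \<sigma>_def)
qed

text \<open>When no member lies in \<open>W\<close>, every residual is nonempty, so
  \<open>expected_large_residuals\<close> with \<open>s = 0\<close> counts all of \<open>I\<close>.
  The binomial theorem without its term \<open>t = 0\<close> gives the right-hand side.\<close>

lemma miss_prob_final_step:
  assumes "finite X" "finite I"
    and "\<And>i. i \<in> I \<Longrightarrow> A i \<subseteq> X" "\<And>i. i \<in> I \<Longrightarrow> card (A i) \<le> r"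
    and "spread q M X I A" "0 < p" "p \<le> 1" "0 \<le> q" "0 \<le> M"
  shows "miss_prob p X I A * card I \<le> M * ((1 + q / p) ^ r - 1)"
proof -
  have "miss_prob p X I A * card I \<le>
      biased_sum p X (\<lambda>W. real (card {i \<in> I. 0 < card (residual A I W i)}))"
    unfolding miss_prob_def mult.commute[of _ "real (card I)"] biased_sum_cmult[symmetric]
  proof (intro biased_sum_mono)
    fix W assume "W \<subseteq> X"
    have "{i \<in> I. 0 < card (residual A I W i)} = I" if "\<forall>i\<in>I. \<not> A i \<subseteq> W"
    proof safe
      fix i assume i: "i \<in> I"
      then obtain j where "j \<in> I" "residual A I W i = A j - W"
        by (rule residual_eq)
      moreover have "finite (A j)" using \<open>j \<in> I\<close> assms finite_subset by metis
      ultimately show "0 < card (residual A I W i)" using that by (auto simp: card_gt_0_iff)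
    qed
    then show "real (card I) * of_bool (\<forall>i\<in>I. \<not> A i \<subseteq> W) \<le>
        real (card {i \<in> I. 0 < card (residual A I W i)})"
      by (cases "\<forall>i\<in>I. \<not> A i \<subseteq> W") (simp_all only: of_bool_eq, simp_all)
  qed (use assms in auto)
  also have "\<dots> \<le> M * (\<Sum>t\<in>{0<..r}. real (r choose t) * (q / p) ^ t)"
    using assms by (intro expected_large_residuals) auto
  also have "(\<Sum>t\<in>{0<..r}. real (r choose t) * (q / p) ^ t) = (1 + q / p) ^ r - 1"
  proof -
    have "(q / p + 1) ^ r = (\<Sum>t\<le>r. real (r choose t) * (q / p) ^ t)"
      by (simp add: binomial_ring)
    also have "{..r} = insert 0 {0<..r}" by auto
    finally show ?thesis by (simp add: add.commute)
  qed
  finally show ?thesis .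
qed

text \<open>Expose \<open>V\<close> of density \<open>64 * q\<close>, then an independent set of
  density \<open>p\<close>. Indices whose residual has at most \<open>r div 2\<close> elements form
  a spread family to which \<open>IH\<close> applies; covering a residual in the second round covers
  a member in total. The remaining indices are charged in full, and few of them are
  expected.\<close>

lemma miss_prob_halving_step:
  fixes I :: "'i set"
  assumes fin: "finite X" "finite I"
    and A: "\<And>i. i \<in> I \<Longrightarrow> A i \<subseteq> X" "\<And>i. i \<in> I \<Longrightarrow> card (A i) \<le> r"
    and spr: "spread q M X I A" and q: "0 < q" "64 * q \<le> 1" and M: "0 \<le> M"
    and p: "0 \<le> p" "p \<le> 1"
    and IH: "\<And>(I' :: 'i set) A'. finite I' \<Longrightarrow> (\<And>i. i \<in> I' \<Longrightarrow> A' i \<subseteq> X) \<Longrightarrow>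
      (\<And>i. i \<in> I' \<Longrightarrow> card (A' i) \<le> r div 2) \<Longrightarrow> spread q M X I' A' \<Longrightarrow>
      miss_prob p X I' A' * card I' \<le> M * \<delta>"
  shows "miss_prob (64 * q + p - 64 * q * p) X I A * card I \<le> M * (\<delta> + (1 / 4) ^ r)"
proof -
  let ?J = "\<lambda>W. {i \<in> I. card (residual A I W i) \<le> r div 2}"
  let ?L = "\<lambda>W. {i \<in> I. r div 2 < card (residual A I W i)}"
  have "miss_prob (64 * q + p - 64 * q * p) X I A * card I =
      biased_sum (64 * q) X (\<lambda>V. real (card I) *
        biased_sum p X (\<lambda>W. of_bool (\<forall>i\<in>I. \<not> A i \<subseteq> V \<union> W)))"
    unfolding miss_prob_def biased_sum_cmult
    by (subst biased_sum_union[OF fin(1)]) simp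
  also have "\<dots> \<le> biased_sum (64 * q) X (\<lambda>V. M * \<delta> + real (card (?L V)))"
  proof (intro biased_sum_mono)
    fix V assume V: "V \<subseteq> X"
    have "biased_sum p X (\<lambda>W. of_bool (\<forall>i\<in>I. \<not> A i \<subseteq> V \<union> W)) \<le>
        miss_prob p X (?J V) (residual A I V)"
      unfolding miss_prob_def
    proof (intro biased_sum_mono p)
      fix W
      have "\<exists>j\<in>I. A j \<subseteq> V \<union> W" if i: "i \<in> I" and "residual A I V i \<subseteq> W" for i
        using residual_eq[OF i, of A V] that(2) by (metis Diff_subset_conv)
      then show "of_bool (\<forall>i\<in>I. \<not> A i \<subseteq> V \<union> W) \<le>
          (of_bool (\<forall>i\<in>?J V. \<not> residual A I V i \<subseteq> W) :: real)"
        by auto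
    qed
    then have "real (card I) * biased_sum p X (\<lambda>W. of_bool (\<forall>i\<in>I. \<not> A i \<subseteq> V \<union> W)) \<le>
        real (card I) * miss_prob p X (?J V) (residual A I V)"
      by (rule mult_left_mono) simp
    also have "\<dots> = real (card (?J V) + card (?L V)) * miss_prob p X (?J V) (residual A I V)"
    proof -
      have "I = ?J V \<union> ?L V" by auto
      then have "card I = card (?J V) + card (?L V)" using fin(2)
        by (metis (no_types, lifting) card_Un_disjoint disjoint_iff finite_Un
            mem_Collect_eq not_le)
      then show ?thesis by simp
    qed
    \<comment> \<open>For the large residuals the miss probability is bounded by 1, so they
      contribute their number.\<close>
    also have "real (card (?J V) + card (?L V)) * miss_prob p X (?J V) (residual A I V) \<le>
        miss_prob p X (?J V) (residual A I V) * real (card (?J V)) + real (card (?L V)) * 1"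
      using miss_prob_le_1[OF fin(1) p, of "?J V" "residual A I V"]
        mult_left_mono[of "miss_prob p X (?J V) (residual A I V)" 1 "real (card (?L V))"]
      by (simp add: algebra_simps)
    also have "miss_prob p X (?J V) (residual A I V) * real (card (?J V)) \<le> M * \<delta>"
    proof (rule IH)
      show "finite (?J V)" using fin by simp
      show "residual A I V i \<subseteq> X" if "i \<in> ?J V" for i
        using that residual_subset[of i I A V] A(1)[of i] by blast
      show "card (residual A I V i) \<le> r div 2" if "i \<in> ?J V" for i using that by simp
      show "spread q M X (?J V) (residual A I V)"
        unfolding spread_def
      proof (intro allI impI)
        fix U assume "U \<subseteq> X"
        have "card {i \<in> ?J V. U \<subseteq> residual A I V i} \<le> card {i \<in> I. U \<subseteq> A i}"
          using fin residual_subset[of _ I A V] by (intro card_mono) auto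
        also have "real \<dots> \<le> q ^ card U * M"
          using spr \<open>U \<subseteq> X\<close> by (simp add: spread_def)
        finally show "real (card {i \<in> ?J V. U \<subseteq> residual A I V i}) \<le> q ^ card U * M"
          by simp
      qed
    qed
    finally show "real (card I) * biased_sum p X (\<lambda>W. of_bool (\<forall>i\<in>I. \<not> A i \<subseteq> V \<union> W)) \<le>
        M * \<delta> + real (card (?L V))" by simp
  qed (use q in auto)
  also have "\<dots> = M * \<delta> + biased_sum (64 * q) X (\<lambda>V. real (card (?L V)))"
    using fin by (simp add: biased_sum_add biased_sum_const)
  also have "biased_sum (64 * q) X (\<lambda>V. real (card (?L V))) \<le>
      M * (\<Sum>t\<in>{r div 2<..r}. real (r choose t) * (q / (64 * q)) ^ t)"
    using assms by (intro expected_large_residuals) auto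
  \<comment> \<open>Since \<open>64 = 8 ^ 2\<close> and \<open>r \<le> 2 * t\<close>, each power is
    at most \<open>(1 / 8) ^ r\<close>; the binomials add up to at most \<open>2 ^ r\<close>, which
    leaves \<open>(1 / 4) ^ r\<close>.\<close>
  also have "(\<Sum>t\<in>{r div 2<..r}. real (r choose t) * (q / (64 * q)) ^ t) \<le>
      (\<Sum>t\<in>{r div 2<..r}. real (r choose t) * (1 / 8) ^ r)"
  proof (intro sum_mono mult_left_mono)
    fix t assume "t \<in> {r div 2<..r}"
    then have "r \<le> 2 * t" by auto
    have "(q / (64 * q)) ^ t = (1 / 8) ^ (2 * t)"
      using q by (simp add: power_mult power_divide power2_eq_square)
    also have "\<dots> \<le> (1 / 8) ^ r" using \<open>r \<le> 2 * t\<close> by (intro power_decreasing) auto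
    finally show "(q / (64 * q)) ^ t \<le> (1 / 8) ^ r" .
  qed simp
  also have "\<dots> \<le> (\<Sum>t\<le>r. real (r choose t) * (1 / 8) ^ r)"
    by (intro sum_mono2) auto
  also have "\<dots> = 2 ^ r * (1 / 8) ^ r"
    using choose_row_sum[of r] by (simp flip: sum_distrib_right of_nat_sum)
  also have "\<dots> = (1 / 4) ^ r" by (simp flip: power_mult_distrib)
  finally show ?thesis using M by (simp add: distrib_left mult_left_mono)
qed

text \<open>Each halving round lowers the exponent \<open>J\<close> in \<open>r < 2 ^ J\<close> by
  one. \<open>R\<close> is the size at which halving stops and one round of density
  \<open>q * b\<close> finishes, which gives the first error term. The halving errors occur at
  distinct sizes above \<open>R\<close>, hence the sum.\<close>

theorem spread_miss_prob:
  fixes I :: "'i set"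
  assumes fin: "finite X" "finite I"
    and A: "\<And>i. i \<in> I \<Longrightarrow> A i \<subseteq> X" "\<And>i. i \<in> I \<Longrightarrow> card (A i) \<le> r"
    and spr: "spread q M X I A" and q: "0 < q" and b: "0 < b" and M: "0 \<le> M"
    and r: "r < 2 ^ J" and p: "q * b + real J * (64 * q) \<le> 1"
  shows "miss_prob (q * b + real J * (64 * q)) X I A * card I
    \<le> M * ((1 + 1 / b) ^ R - 1 + (\<Sum>j\<in>{R<..r}. (1 / 4) ^ j))"
  using fin(2) A spr r p
proof (induction J arbitrary: I A r)
  case (0 I A r)
  have "miss_prob (q * b) X I A * card I \<le> M * ((1 + q / (q * b)) ^ r - 1)"
    using 0 fin(1) q b M by (intro miss_prob_final_step) auto
  also have "\<dots> \<le> M * ((1 + 1 / b) ^ R - 1 + (\<Sum>j\<in>{R<..r}. (1 / 4) ^ j))"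
    using 0 q b M by (intro mult_left_mono) (auto intro!: add_nonneg_nonneg sum_nonneg)
  finally show ?case by simp
next
  case (Suc J I A r)
  have b0: "0 \<le> q * b" and J0: "0 \<le> real J * (64 * q)" and qb: "0 < q * b" using q b by auto
  have eq: "real (Suc J) * (64 * q) = real J * (64 * q) + 64 * q" by (simp add: algebra_simps)
  show ?case
  proof (cases "r \<le> R")
    case True
    \<comment> \<open>The remaining halving rounds only raise the density, so they are
      dropped.\<close>
    have "miss_prob (q * b + real (Suc J) * (64 * q)) X I A * card I \<le> miss_prob (q * b) X I A * card I"
      using fin(1) b0 q Suc.prems by (intro mult_right_mono miss_prob_antimono) auto
    also have "\<dots> \<le> M * ((1 + q / (q * b)) ^ r - 1)"
    proof (rule miss_prob_final_step)
      show "q * b \<le> 1" using Suc.prems(6) J0 eq q by linarith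
    qed (use Suc.prems fin(1) qb q M in auto)
    also have "\<dots> \<le> M * ((1 + 1 / b) ^ R - 1 + (\<Sum>j\<in>{R<..r}. (1 / 4) ^ j))"
      using True q b M
      by (intro mult_left_mono) (auto intro!: add_increasing2 sum_nonneg power_increasing)
    finally show ?thesis .
  next
    case False
    let ?p = "q * b + real J * (64 * q)"
    let ?\<delta> = "(1 + 1 / b) ^ R - 1 + (\<Sum>j\<in>{R<..r div 2}. (1 / 4 :: real) ^ j)"
    have p: "0 \<le> ?p" "?p + 64 * q \<le> 1" using b0 J0 Suc.prems(6) eq by auto
    have q64: "64 * q \<le> 1" using p by simp
    have le: "64 * q * ?p \<le> 64 * q * 1" using p q by (intro mult_left_mono) auto
    have "0 \<le> 64 * q * ?p" using p q by (intro mult_nonneg_nonneg) auto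
    then have "0 \<le> 64 * q + ?p - 64 * q * ?p"
      "64 * q + ?p - 64 * q * ?p \<le> q * b + real (Suc J) * (64 * q)"
      using le p(1) eq by linarith+
    then have "miss_prob (q * b + real (Suc J) * (64 * q)) X I A * card I \<le>
        miss_prob (64 * q + ?p - 64 * q * ?p) X I A * card I"
      using fin(1) Suc.prems(6) by (intro mult_right_mono miss_prob_antimono) auto
    also have "\<dots> \<le> M * (?\<delta> + (1 / 4) ^ r)"
      using Suc.prems fin(1) p q q64 M
      by (intro miss_prob_halving_step Suc.IH) auto
    also have "\<dots> \<le> M * ((1 + 1 / b) ^ R - 1 + (\<Sum>j\<in>{R<..r}. (1 / 4) ^ j))"
    proof (intro mult_left_mono M)
      \<comment> \<open>Here \<open>r div 2 < r\<close>, so the new error is a summand not yet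
        present.\<close>
      have "(\<Sum>j\<in>{R<..r div 2}. (1 / 4 :: real) ^ j) + (1 / 4) ^ r =
          (\<Sum>j\<in>insert r {R<..r div 2}. (1 / 4) ^ j)"
        using False by simp
      also have "\<dots> \<le> (\<Sum>j\<in>{R<..r}. (1 / 4) ^ j)"
        using False by (intro sum_mono2) auto
      finally show "?\<delta> + (1 / 4) ^ r \<le> (1 + 1 / b) ^ R - 1 + (\<Sum>j\<in>{R<..r}. (1 / 4) ^ j)"
        by simp
    qed
    finally show ?thesis .
  qed
qed

section \<open>Random placements are spread\<close>

lemma card_inj_funcset:
  assumes "finite A" "finite B" "card A = card B"
  shows "card {f \<in> A \<rightarrow>\<^sub>E B. inj_on f A} = fact (card A)"
  using card_inj_on_subset_funcset[OF assms(1,2), of A] assms(3)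
  by (simp add: fact_prod_rev)

text \<open>A single term of the exponential series gives \<open>t ^ t \<le> exp t * fact t\<close>;
  combine it with \<open>(N / t) ^ t \<le> N choose t\<close>. It turns the chance of fixing
  \<open>t\<close> values of a random bijection into a power of \<open>exp 1 / N\<close>.\<close>

lemma power_mult_fact_le:
  assumes "t \<le> N"
  shows "real N ^ t * fact (N - t) \<le> exp (real t) * fact N"
proof (cases "t = 0")
  case False
  have "(\<Sum>i\<in>{t}. real t ^ i / fact i) \<le> exp (real t)"
    using sum_le_suminf[of "\<lambda>i. real t ^ i /\<^sub>R fact i" "{t}"] exp_converges[of "real t"]
    by (auto simp: sums_iff divide_inverse mult.commute)
  then have "real t ^ t \<le> exp (real t) * fact t"
    by (simp add: divide_le_eq)
  moreover have "(real N / real t) ^ t \<le> real (N choose t)"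
    using assms by (rule binomial_ge_n_over_k_pow_k)
  ultimately have "real t ^ t * (real N / real t) ^ t \<le> exp (real t) * fact t * real (N choose t)"
    by (intro mult_mono) auto
  then have "real N ^ t \<le> exp (real t) * fact t * real (N choose t)"
    using False by (simp flip: power_mult_distrib)
  then have "real N ^ t * fact (N - t) \<le>
      exp (real t) * (fact t * fact (N - t) * real (N choose t))"
    by (simp add: mult_right_mono mult.assoc mult.left_commute)
  also have "fact t * fact (N - t) * real (N choose t) = fact N"
    using binomial_fact_lemma[OF assms] by (metis of_nat_fact of_nat_mult)
  finally show ?thesis .
qed simp

text \<open>Positions are pairs (path, depth). The roots \<^term>\<open>Z\<close> occupy the depth-0 positions given by
  \<^term>\<open>g\<close>; a placement puts the remaining vertices \<^term>\<open>R\<close> on the remaining positions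
  \<^term>\<open>Q\<close>.\<close>

locale rooted_layout =
  fixes R Z :: "'v set" and Q :: "(nat \<times> nat) set" and g :: "'v \<Rightarrow> nat \<times> nat"
  assumes finite_R: "finite R" and disjoint: "R \<inter> Z = {}"
    and finite_Q: "finite Q" and card_Q: "card Q = card R"
    and depth_Q: "x \<in> Q \<Longrightarrow> 0 < snd x"
    and depth_g: "z \<in> Z \<Longrightarrow> snd (g z) = 0" and inj_g: "inj_on g Z"
begin

definition pos :: "('v \<Rightarrow> nat \<times> nat) \<Rightarrow> 'v \<Rightarrow> nat \<times> nat" where
  "pos f x = (if x \<in> R then f x else g x)"

definition placements :: "('v \<Rightarrow> nat \<times> nat) set" where
  "placements = {f \<in> R \<rightarrow>\<^sub>E Q. inj_on f R}"

text \<open>Arcs lead away from the root, one step deeper on the same path. The head lies in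
  \<open>R\<close> because roots sit at depth 0.\<close>

definition arc :: "('v \<Rightarrow> nat \<times> nat) \<Rightarrow> 'v \<Rightarrow> 'v \<Rightarrow> bool" where
  "arc f a b \<longleftrightarrow> a \<in> R \<union> Z \<and> b \<in> R \<and> pos f b = apsnd Suc (pos f a)"

definition edges :: "('v \<Rightarrow> nat \<times> nat) \<Rightarrow> 'v set set" where
  "edges f = {{a, b} | a b. arc f a b}"

lemma finite_placements: "finite placements"
  unfolding placements_def using finite_R finite_Q by (simp add: finite_PiE)

lemma card_placements: "card placements = fact (card R)"
  unfolding placements_def using finite_R finite_Q card_Q by (intro card_inj_funcset) auto

text \<open>Positive depth on \<open>R\<close> and depth 0 on \<open>Z\<close> keep the two images
  apart.\<close>

lemma inj_pos:
  assumes "f \<in> placements"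
  shows "inj_on (pos f) (R \<union> Z)"
proof (rule inj_onI)
  fix x y assume "x \<in> R \<union> Z" "y \<in> R \<union> Z" "pos f x = pos f y"
  moreover have "0 < snd (f x)" if "x \<in> R" for x
    using that assms by (intro depth_Q) (auto simp: placements_def)
  ultimately show "x = y"
    using assms depth_g inj_g disjoint
    by (auto simp: pos_def placements_def dest: inj_onD split: if_splits) force+
qed

lemma arc_parent_unique:
  assumes "f \<in> placements" "arc f a b" "arc f a' b"
  shows "a = a'"
proof -
  have "pos f a = pos f a'"
    using assms by (auto simp: arc_def apsnd_def map_prod_def split: prod.splits)
  then show ?thesis using inj_pos assms by (auto simp: arc_def dest: inj_onD)
qed

lemma arc_depth: "arc f a b \<Longrightarrow> snd (pos f b) = Suc (snd (pos f a))"
  by (auto simp: arc_def)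

lemma arc_irrefl: "\<not> arc f a a"
  using arc_depth by fastforce

text \<open>An edge is recovered from its child, which lies in \<open>R\<close>.\<close>

lemma card_edges_le:
  assumes "f \<in> placements"
  shows "card (edges f) \<le> card R" "finite (edges f)"
proof -
  have sub: "edges f \<subseteq> (\<lambda>b. {THE a. arc f a b, b}) ` R"
  proof
    fix e assume "e \<in> edges f"
    then obtain a b where ab: "e = {a, b}" "arc f a b" by (auto simp: edges_def)
    then have "(THE a. arc f a b) = a" using arc_parent_unique[OF assms] by blast
    then have "e = {THE a. arc f a b, b}" using ab(1) by simp
    moreover have "b \<in> R" using ab(2) by (simp add: arc_def)
    ultimately show "e \<in> (\<lambda>b. {THE a. arc f a b, b}) ` R" by (rule image_eqI)
  qed
  then show "card (edges f) \<le> card R" using finite_R by (rule surj_card_le[rotated])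
  show "finite (edges f)" using sub finite_R by (meson finite_imageI finite_subset)
qed

text \<open>All members of \<open>F\<close> occupy the same positions on \<open>D\<close>, so
  restriction to \<open>R - D\<close> embeds \<open>F\<close> into the bijections onto the positions
  left over.\<close>

lemma card_agreeing_placements:
  assumes "F \<subseteq> placements" "D \<subseteq> R"
    and agree: "\<And>f f' x. f \<in> F \<Longrightarrow> f' \<in> F \<Longrightarrow> x \<in> D \<Longrightarrow> f x = f' x"
  shows "card F \<le> fact (card R - card D)"
proof (cases "F = {}")
  case False
  then obtain f0 where f0: "f0 \<in> F" by auto
  have finD: "finite D" using assms finite_R finite_subset by blast
  have P: "f \<in> R \<rightarrow>\<^sub>E Q" "inj_on f R" if "f \<in> F" for f
    using that assms(1) by (auto simp: placements_def)
  have f0D: "f0 ` D \<subseteq> Q" using P[OF f0] assms(2) by auto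
  have "card (f0 ` D) = card D"
    using P[OF f0] assms(2) by (intro card_image) (auto intro: inj_on_subset)
  then have card_eq: "card (R - D) = card (Q - f0 ` D)"
    using finD f0D assms(2) card_Q by (simp add: card_Diff_subset)
  have "card F \<le> card {h \<in> (R - D) \<rightarrow>\<^sub>E (Q - f0 ` D). inj_on h (R - D)}"
  proof (rule card_inj_on_le[where f = "\<lambda>f. restrict f (R - D)"])
    show "inj_on (\<lambda>f. restrict f (R - D)) F"
    proof (rule inj_onI)
      fix f f' assume ff: "f \<in> F" "f' \<in> F" "restrict f (R - D) = restrict f' (R - D)"
      show "f = f'"
      proof (rule PiE_ext[OF P(1)[OF ff(1)] P(1)[OF ff(2)]])
        fix x assume "x \<in> R"
        then show "f x = f' x"
          using agree[OF ff(1,2)] fun_cong[OF ff(3), of x] by (cases "x \<in> D") auto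
      qed
    qed
    show "(\<lambda>f. restrict f (R - D)) ` F \<subseteq> {h \<in> (R - D) \<rightarrow>\<^sub>E (Q - f0 ` D). inj_on h (R - D)}"
    proof (rule image_subsetI, intro CollectI conjI)
      fix f assume f: "f \<in> F"
      have img: "f0 ` D = f ` D" using agree[OF f f0] by auto
      have "f x \<in> Q - f ` D" if "x \<in> R - D" for x
        using P[OF f] that assms(2) by (auto dest: inj_onD)
      then show "restrict f (R - D) \<in> (R - D) \<rightarrow>\<^sub>E (Q - f0 ` D)"
        unfolding img by auto
      show "inj_on (restrict f (R - D)) (R - D)"
        using P[OF f] by (auto intro: inj_on_subset simp: inj_on_def)
    qed
    show "finite {h \<in> (R - D) \<rightarrow>\<^sub>E (Q - f0 ` D). inj_on h (R - D)}"
      using finite_R finite_Q by (simp add: finite_PiE)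
  qed
  also have "\<dots> = fact (card (R - D))"
    using finite_R finite_Q card_eq by (intro card_inj_funcset) auto
  also have "card (R - D) = card R - card D"
    using finD assms(2) by (rule card_Diff_subset)
  finally show ?thesis .
qed simp

text \<open>Here \<^term>\<open>c\<close> selects the deeper endpoint of every edge. A placement is then determined on
  all these endpoints by its values on the parents that are neither children nor roots.\<close>

definition oriented :: "'v set set \<Rightarrow> ('v set \<Rightarrow> 'v) \<Rightarrow> ('v \<Rightarrow> nat \<times> nat) set" where
  "oriented U c = {f \<in> placements. \<forall>e\<in>U. \<exists>a. e = {a, c e} \<and> arc f a (c e)}"

definition tops :: "'v set set \<Rightarrow> ('v set \<Rightarrow> 'v) \<Rightarrow> 'v set" where
  "tops U c = (\<Union>e\<in>U. e - {c e}) - c ` U - Z"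

text \<open>Induction on depth: the position of a child follows from that of its parent, and the
  parent is a root, a top, or a child of smaller depth.\<close>

lemma oriented_determined:
  assumes "f \<in> oriented U c" "f' \<in> oriented U c"
    and agree: "\<And>x. x \<in> tops U c \<Longrightarrow> f x = f' x"
    and "b \<in> c ` U"
  shows "f b = f' b"
  using assms(4)
proof (induction "snd (pos f b)" arbitrary: b rule: less_induct)
  case less
  then obtain e where e: "e \<in> U" "b = c e" by auto
  obtain a where a: "e = {a, b}" "arc f a b" using assms(1) e by (auto simp: oriented_def)
  obtain a' where a': "e = {a', b}" "arc f' a' b" using assms(2) e by (auto simp: oriented_def)
  \<comment> \<open>Both placements share the edge \<open>e\<close> and its child \<open>b\<close>,
    hence also the parent.\<close>
  have [simp]: "a' = a" using a a' arc_irrefl by (metis doubleton_eq_iff)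
  have "a \<noteq> b" using a arc_irrefl by metis
  have "pos f a = pos f' a"
  proof (cases "a \<in> Z")
    case True
    then show ?thesis using disjoint by (auto simp: pos_def)
  next
    case False
    show ?thesis
    proof (cases "a \<in> c ` U")
      case True
      then have "f a = f' a" using less(1)[of a] arc_depth[OF a(2)] by simp
      then show ?thesis by (simp add: pos_def)
    next
      case False
      moreover have "a \<in> e - {c e}" using \<open>a \<noteq> b\<close> e(2) a(1) by blast
      ultimately have "a \<in> tops U c" using \<open>a \<notin> Z\<close> e(1) unfolding tops_def by blast
      then show ?thesis using agree by (simp add: pos_def)
    qed
  qed
  then have "pos f b = pos f' b" using a(2) a'(2) by (simp add: arc_def)
  then show ?case using a(2) by (simp add: pos_def arc_def)
qed

text \<open>Take \<open>t\<close> to be the number of tops, at most one per edge. Unique parents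
  make the \<open>card U\<close> children distinct. Fixing the tops, in at most
  \<open>card R ^ t\<close> ways, also fixes the children, so \<open>card U + t\<close> values are
  settled.\<close>

lemma card_oriented_le:
  assumes "finite U" "oriented U c \<noteq> {}"
  shows "\<exists>t\<le>card U. card U + t \<le> card R \<and>
    card (oriented U c) \<le> card R ^ t * fact (card R - (card U + t))"
proof -
  obtain f0 where f0: "f0 \<in> oriented U c" using assms by auto
  then have f0p: "f0 \<in> placements" by (simp add: oriented_def)
  let ?C = "tops U c" and ?B = "c ` U"
  have arc0: "\<exists>a. e = {a, c e} \<and> arc f0 a (c e)" if "e \<in> U" for e
    using f0 that by (simp add: oriented_def)
  have inj: "inj_on c U"
    by (rule inj_onI) (metis arc0 arc_parent_unique[OF f0p])
  then have cardB: "card ?B = card U" by (rule card_image)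
  have BR: "?B \<subseteq> R" using arc0 by (auto simp: arc_def)
  have CR: "?C \<subseteq> R" using arc0 by (force simp: tops_def arc_def)
  have finB: "finite ?B" "finite ?C" using BR CR finite_R finite_subset by blast+
  have "card (\<Union>e\<in>U. e - {c e}) \<le> (\<Sum>e\<in>U. card (e - {c e}))"
    using assms(1) by (rule card_UN_le)
  also have "\<dots> \<le> (\<Sum>e\<in>U. 1)"
  proof (rule sum_mono)
    fix e assume "e \<in> U"
    then obtain a where "e = {a, c e}" using arc0 by blast
    then have "e - {c e} \<subseteq> {a}" by blast
    then show "card (e - {c e}) \<le> 1" using card_mono[of "{a}"] by fastforce
  qed
  finally have "card (\<Union>e\<in>U. e - {c e}) \<le> card U" by simp
  moreover have "finite (\<Union>e\<in>U. e - {c e})"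
    using assms(1) arc0 by (metis (no_types, lifting) finite.emptyI finite.insertI
        finite_Diff finite_UN_I)
  then have "card ?C \<le> card (\<Union>e\<in>U. e - {c e})"
    unfolding tops_def by (intro card_mono) auto
  ultimately have C_le: "card ?C \<le> card U" by linarith
  have "?B \<inter> ?C = {}" by (auto simp: tops_def)
  then have card_un: "card (?B \<union> ?C) = card U + card ?C"
    using finB cardB by (simp add: card_Un_disjoint)
  then have sum_le: "card U + card ?C \<le> card R"
    using BR CR finite_R by (metis Un_least card_mono)
  let ?F = "\<lambda>h. {f \<in> oriented U c. restrict f ?C = h}"
  have "oriented U c \<subseteq> (\<Union>h\<in>?C \<rightarrow>\<^sub>E Q. ?F h)"
  proof
    fix f assume f: "f \<in> oriented U c"
    then have "restrict f ?C \<in> ?C \<rightarrow>\<^sub>E Q"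
      using CR by (auto simp: oriented_def placements_def)
    then show "f \<in> (\<Union>h\<in>?C \<rightarrow>\<^sub>E Q. ?F h)" using f by blast
  qed
  moreover have fin: "finite (?C \<rightarrow>\<^sub>E Q)" using finB finite_Q by (simp add: finite_PiE)
  moreover have "finite (oriented U c)"
    using finite_placements by (simp add: oriented_def)
  ultimately have "card (oriented U c) \<le> card (\<Union>h\<in>?C \<rightarrow>\<^sub>E Q. ?F h)"
    by (intro card_mono) auto
  also have "\<dots> \<le> (\<Sum>h\<in>?C \<rightarrow>\<^sub>E Q. card (?F h))"
    using fin by (rule card_UN_le)
  also have "\<dots> \<le> (\<Sum>h\<in>?C \<rightarrow>\<^sub>E Q. fact (card R - (card U + card ?C)))"
  proof (rule sum_mono)
    fix h
    have "f x = f' x" if f: "f \<in> ?F h" "f' \<in> ?F h" and x: "x \<in> ?B \<union> ?C" for f f' x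
    proof -
      have C: "f y = f' y" if "y \<in> ?C" for y
      proof -
        have "restrict f ?C y = restrict f' ?C y" using f by simp
        then show ?thesis using that by simp
      qed
      show ?thesis
      proof (cases "x \<in> ?C")
        case False
        show ?thesis by (rule oriented_determined[of f U c f']) (use f x C False in auto)
      qed (rule C)
    qed
    then have "card (?F h) \<le> fact (card R - card (?B \<union> ?C))"
      using BR CR by (intro card_agreeing_placements) (auto simp: oriented_def)
    then show "card (?F h) \<le> fact (card R - (card U + card ?C))" by (simp only: card_un)
  qed
  also have "\<dots> = card R ^ card ?C * fact (card R - (card U + card ?C))"
    using finB card_Q by (simp add: card_funcsetE)
  finally show ?thesis using C_le sum_le by blast
qed

text \<open>The factor \<open>card R ^ t\<close> is absorbed by the \<open>t\<close> additional
  fixed values; since \<open>t \<le> card U\<close>, the exponential cost is at most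
  \<open>exp 2\<close> per edge.\<close>

lemma card_oriented_le_real:
  assumes "finite U" "R \<noteq> {}"
  shows "real (card (oriented U c)) \<le> (exp 2 / card R) ^ card U * fact (card R)"
proof (cases "oriented U c = {}")
  case False
  let ?N = "card R" and ?s = "card U"
  have N: "0 < real ?N" using assms(2) finite_R by (simp add: card_gt_0_iff)
  obtain t where t: "t \<le> ?s" "?s + t \<le> ?N"
    "card (oriented U c) \<le> ?N ^ t * fact (?N - (?s + t))"
    using card_oriented_le[OF assms(1) False] by blast
  have "real (card (oriented U c)) \<le> real (?N ^ t * fact (?N - (?s + t)))"
    using t(3) by (rule of_nat_mono)
  also have "\<dots> = real ?N ^ (?s + t) * fact (?N - (?s + t)) / real ?N ^ ?s"
    using N by (simp add: power_add)
  also have "\<dots> \<le> exp (real (?s + t)) * fact ?N / real ?N ^ ?s"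
    using t(2) by (intro divide_right_mono power_mult_fact_le) auto
  also have "\<dots> \<le> exp (real ?s * 2) * fact ?N / real ?N ^ ?s"
    using t(1) by (intro divide_right_mono mult_right_mono) auto
  also have "\<dots> = (exp 2 / ?N) ^ ?s * fact ?N"
    by (simp add: exp_of_nat_mult power_divide)
  finally show ?thesis .
qed simp

text \<open>A union bound over the \<open>2 ^ card U\<close> ways to declare one endpoint of each
  edge the child.\<close>

lemma card_containing_placements_le:
  assumes "R \<noteq> {}"
  shows "real (card {f \<in> placements. U \<subseteq> edges f}) \<le> (2 * exp 2 / card R) ^ card U * fact (card R)"
proof (cases "{f \<in> placements. U \<subseteq> edges f} = {}")
  case True
  then show ?thesis by (simp only: card.empty) simp
next
  case False
  then obtain f0 where f0: "f0 \<in> placements" "U \<subseteq> edges f0" by auto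
  have finU: "finite U" using f0 card_edges_le(2) finite_subset by blast
  have card2: "card e = 2" "finite e" if "e \<in> U" for e
  proof -
    have "e \<in> edges f0" using f0(2) that by blast
    then obtain a b where "e = {a, b}" "arc f0 a b" unfolding edges_def by blast
    moreover from this have "a \<noteq> b" using arc_irrefl by metis
    ultimately show "card e = 2" "finite e" by auto
  qed
  let ?O = "\<Pi>\<^sub>E e\<in>U. e"
  have finO: "finite ?O" using finU card2 by (intro finite_PiE) auto
  have cardO: "card ?O = 2 ^ card U" using finU card2 by (simp add: card_PiE)
  have "{f \<in> placements. U \<subseteq> edges f} \<subseteq> (\<Union>c\<in>?O. oriented U c)"
  proof safe
    fix f assume f: "f \<in> placements" "U \<subseteq> edges f"
    then have "\<forall>e\<in>U. \<exists>b. \<exists>a. e = {a, b} \<and> arc f a b"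
      unfolding edges_def by blast
    then obtain c where c: "\<forall>e\<in>U. \<exists>a. e = {a, c e} \<and> arc f a (c e)" by metis
    then have "\<forall>e\<in>U. c e \<in> e" by blast
    then have "restrict c U \<in> ?O" by auto
    moreover have "f \<in> oriented U (restrict c U)" using f c by (simp add: oriented_def)
    ultimately show "f \<in> (\<Union>c\<in>?O. oriented U c)" by blast
  qed
  then have "card {f \<in> placements. U \<subseteq> edges f} \<le> card (\<Union>c\<in>?O. oriented U c)"
    using finO finite_placements by (intro card_mono finite_UN_I) (auto simp: oriented_def)
  also have "\<dots> \<le> (\<Sum>c\<in>?O. card (oriented U c))"
    using finO by (rule card_UN_le)
  finally have "real (card {f \<in> placements. U \<subseteq> edges f}) \<le> (\<Sum>c\<in>?O. real (card (oriented U c)))"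
    by (simp flip: of_nat_sum)
  also have "\<dots> \<le> (\<Sum>c\<in>?O. (exp 2 / card R) ^ card U * fact (card R))"
    using finU assms by (intro sum_mono card_oriented_le_real)
  also have "\<dots> = (2 * exp 2 / card R) ^ card U * fact (card R)"
    by (simp add: cardO power_divide power_mult_distrib)
  finally show ?thesis .
qed

end

section \<open>Path systems in the random graph\<close>

lemma finite_all_edges: "finite (all_edges n)"
proof (rule finite_subset)
  show "all_edges n \<subseteq> Pow {1..n}" by (auto simp: all_edges_def)
qed simp

lemma pmf_Gnp:
  assumes "0 \<le> p" "p \<le> 1" "W \<subseteq> all_edges n"
  shows "pmf (Gnp n p) W = p ^ card W * (1 - p) ^ card (all_edges n - W)"
proof -
  let ?X = "all_edges n" and ?M = "Pi_pmf (all_edges n) False (\<lambda>_. bernoulli_pmf p)"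
  have "pmf (Gnp n p) W = measure_pmf.prob ?M ((\<lambda>f. {e \<in> ?X. f e}) -` {W})"
    by (simp add: Gnp_def pmf_map)
  also have "\<dots> = measure_pmf.prob ?M {\<lambda>x. x \<in> W}"
  proof (rule measure_pmf.finite_measure_eq_AE)
    \<comment> \<open>With default value \<open>False\<close>, almost every \<open>f\<close>
      vanishes outside \<open>all_edges n\<close>, so only the indicator of \<open>W\<close> maps to
      \<open>W\<close>.\<close>
    show "AE f in measure_pmf ?M. f \<in> (\<lambda>f. {e \<in> ?X. f e}) -` {W} \<longleftrightarrow> f \<in> {\<lambda>x. x \<in> W}"
      using set_Pi_pmf_subset[OF finite_all_edges, of n False "\<lambda>_. bernoulli_pmf p"] assms(3)
      by (auto simp: AE_measure_pmf_iff fun_eq_iff)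
  qed auto
  also have "\<dots> = (\<Prod>x\<in>?X. pmf (bernoulli_pmf p) (x \<in> W))"
    unfolding measure_pmf_single
    by (rule pmf_Pi'[OF finite_all_edges]) (use assms(3) in blast)
  also have "\<dots> = (\<Prod>x\<in>?X. if x \<in> W then p else 1 - p)"
    using assms by (intro prod.cong) auto
  also have "\<dots> = p ^ card (?X \<inter> W) * (1 - p) ^ card (?X - W)"
    by (simp add: prod.If_cases finite_all_edges Diff_eq)
  also have "?X \<inter> W = W" using assms(3) by blast
  finally show ?thesis .
qed

lemma prob_Gnp:
  assumes "0 \<le> p" "p \<le> 1"
  shows "measure_pmf.prob (Gnp n p) S = biased_sum p (all_edges n) (\<lambda>W. of_bool (W \<in> S))"
proof -
  let ?X = "all_edges n"
  have "set_pmf (Gnp n p) \<subseteq> Pow ?X" by (auto simp: Gnp_def)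
  then have "measure_pmf.prob (Gnp n p) S = measure_pmf.prob (Gnp n p) (S \<inter> Pow ?X)"
    by (intro measure_pmf.finite_measure_eq_AE) (auto simp: AE_measure_pmf_iff)
  also have "\<dots> = (\<Sum>W\<in>S \<inter> Pow ?X. pmf (Gnp n p) W)"
    using finite_all_edges by (intro measure_measure_pmf_finite) auto
  also have "\<dots> = (\<Sum>W\<in>Pow ?X. pmf (Gnp n p) W * of_bool (W \<in> S))"
    using finite_all_edges by (intro sum.mono_neutral_cong_left) auto
  finally show ?thesis
    unfolding biased_sum_def using assms by (auto simp: pmf_Gnp intro!: sum.cong)
qed

section \<open>From placements to vertex-disjoint paths\<close>

definition has_path_system :: "nat \<Rightarrow> nat \<Rightarrow> (nat \<Rightarrow> nat) \<Rightarrow> nat set set \<Rightarrow> bool" where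
  "has_path_system n k v E \<longleftrightarrow> (\<exists>P :: nat \<Rightarrow> nat list.
    (\<forall>i\<in>{1..n div k}. is_path n E (P i) \<and> length (P i) = k \<and>
      (hd (P i) = v i \<or> last (P i) = v i)) \<and>
    (\<forall>i\<in>{1..n div k}. \<forall>j\<in>{1..n div k}. i \<noteq> j \<longrightarrow> set (P i) \<inter> set (P j) = {}))"

text \<open>Paths on one vertex are treated apart: then every vertex is a root and nothing is left
  to place.\<close>

lemma has_path_system_one:
  assumes "inj_on v {1..n}" "v ` {1..n} \<subseteq> {1..n}"
  shows "has_path_system n 1 v E"
  unfolding has_path_system_def is_path_def
  using assms by (intro exI[of _ "\<lambda>i. [v i]"]) (auto dest: inj_onD)

text \<open>\<open>h\<close> sends a position to the vertex occupying it, so path \<open>i\<close>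
  is row \<open>i\<close> read by increasing depth.\<close>

lemma has_path_systemI:
  assumes "0 < k"
    and bij: "bij_betw h ({1..n div k} \<times> {..<k}) {1..n}"
    and root: "\<And>i. i \<in> {1..n div k} \<Longrightarrow> h (i, 0) = v i"
    and edge: "\<And>i j. i \<in> {1..n div k} \<Longrightarrow> Suc j < k \<Longrightarrow> {h (i, j), h (i, Suc j)} \<in> E"
  shows "has_path_system n k v E"
proof -
  define P where "P i = map (\<lambda>j. h (i, j)) [0..<k]" for i
  have inj: "inj_on h ({1..n div k} \<times> {..<k})" using bij by (rule bij_betw_imp_inj_on)
  have mem: "h x \<in> {1..n}" if "x \<in> {1..n div k} \<times> {..<k}" for x
    using bij that by (rule bij_betwE[THEN bspec])
  have "is_path n E (P i)" if i: "i \<in> {1..n div k}" for i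
    unfolding is_path_def
  proof (intro conjI allI impI)
    show "P i \<noteq> []" using assms(1) by (simp add: P_def)
    have "inj_on (\<lambda>j. h (i, j)) {0..<k}"
    proof (rule inj_onI)
      fix a b assume "a \<in> {0..<k}" "b \<in> {0..<k}" "h (i, a) = h (i, b)"
      then have "(i, a) = (i, b)" using i by (intro inj_onD[OF inj]) auto
      then show "a = b" by simp
    qed
    then show "distinct (P i)" by (simp add: P_def distinct_map)
    show "set (P i) \<subseteq> {1..n}"
    proof
      fix x assume "x \<in> set (P i)"
      then obtain a where "a < k" "x = h (i, a)" by (auto simp: P_def)
      then show "x \<in> {1..n}" using mem[of "(i, a)"] i by simp
    qed
    show "{P i ! j, P i ! Suc j} \<in> E" if "Suc j < length (P i)" for j
      using that edge[OF i] by (simp add: P_def)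
  qed
  moreover have "hd (P i) = v i" if "i \<in> {1..n div k}" for i
    using root[OF that] assms(1) by (simp add: P_def hd_map)
  moreover have "set (P i) \<inter> set (P j) = {}"
    if "i \<in> {1..n div k}" "j \<in> {1..n div k}" "i \<noteq> j" for i j
  proof (rule equals0I)
    fix x assume "x \<in> set (P i) \<inter> set (P j)"
    then obtain a b where "a < k" "b < k" "h (i, a) = h (j, b)" by (auto simp: P_def)
    then have "(i, a) = (j, b)" using that by (intro inj_onD[OF inj]) auto
    then show False using that by simp
  qed
  ultimately show ?thesis
    unfolding has_path_system_def by (intro exI[of _ P]) (simp add: P_def)
qed

lemma sum_quarter_powers_le: "(\<Sum>j\<in>{R<..r}. (1 / 4) ^ j) \<le> (1 / 4 :: real) ^ R"
proof (cases "R \<le> r")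
  case True
  \<comment> \<open>The subtracted \<open>(1 / 4) ^ r\<close> makes the induction go
    through.\<close>
  then have "(\<Sum>j\<in>{R<..r}. (1 / 4) ^ j) \<le> (1 / 4 :: real) ^ R - (1 / 4) ^ r"
  proof (induction r rule: dec_induct)
    case (step r)
    have "{R<..Suc r} = insert (Suc r) {R<..r}" using step by auto
    then have "(\<Sum>j\<in>{R<..Suc r}. (1 / 4 :: real) ^ j) = (1 / 4) ^ r / 4 + (\<Sum>j\<in>{R<..r}. (1 / 4) ^ j)"
      by simp
    moreover have "0 \<le> (1 / 4 :: real) ^ r" by simp
    moreover have "(1 / 4 :: real) ^ Suc r = (1 / 4) ^ r / 4" by simp
    ultimately show ?case using step.IH by linarith
  qed simp
  then show ?thesis by (smt (verit) zero_le_power divide_nonneg_nonneg)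
qed simp

text \<open>The edge sets of placements form a spread family, and a random graph containing one of
  them contains the required paths. So failure is at most as likely as missing every
  placement.\<close>

lemma prob_path_system_ge:
  assumes k: "2 \<le> k" "k dvd n" and n: "1 \<le> n"
    and v: "inj_on v {1..n div k}" "v ` {1..n div k} \<subseteq> {1..n}"
    and b: "0 < b" and J: "n < 2 ^ J"
    and p: "4 * exp 2 / n * b + real J * (64 * (4 * exp 2 / n)) \<le> p" "p \<le> 1"
  shows "measure_pmf.prob (Gnp n p) {E. has_path_system n k v E}
    \<ge> 1 - ((1 + 1 / b) ^ d - 1 + (1 / 4) ^ d)"
proof -
  define m where "m = n div k"
  define Z where "Z = v ` {1..m}"
  define R where "R = {1..n} - Z"
  define Q where "Q = {1..m} \<times> {1..<k}"
  define g where "g x = (inv_into {1..m} v x, 0::nat)" for x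
  have nk: "n = m * k" using k by (simp add: m_def)
  have ZV: "Z \<subseteq> {1..n}" using v by (simp add: Z_def m_def)
  have "card Z = m" using v by (simp add: Z_def m_def card_image)
  then have cardR: "card R = n - m" using ZV by (simp add: R_def card_Diff_subset Z_def)
  have cardQ: "card Q = n - m" by (simp add: Q_def nk diff_mult_distrib2)
  interpret rooted_layout R Z Q g
  proof
    show "inj_on g Z" by (auto simp: inj_on_def g_def Z_def inv_into_injective)
    show "card Q = card R" by (simp only: cardQ cardR)
  qed (auto simp: R_def Q_def g_def)
  have RZ: "R \<union> Z = {1..n}" using ZV by (auto simp: R_def)
  \<comment> \<open>As \<open>k \<ge> 2\<close>, at least half of the vertices are not roots; this
    turns \<open>2 * exp 2 / card R\<close> into at most \<open>4 * exp 2 / n\<close>.\<close>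
  have "2 * m \<le> n" using k by (simp add: nk)
  then have N: "real n \<le> 2 * real (card R)" by (simp add: cardR of_nat_diff)
  then have Npos: "0 < real (card R)" using n by linarith
  then have Rne: "R \<noteq> {}" by auto
  have paths: "has_path_system n k v E" if f: "f \<in> placements" and E: "edges f \<subseteq> E" for f E
  proof (rule has_path_systemI)
    define h where "h = inv_into {1..n} (pos f)"
    have inj: "inj_on (pos f) {1..n}" using inj_pos[OF f] RZ by simp
    \<comment> \<open>An injection between finite sets of equal size is onto, so every position is
      filled.\<close>
    have fRQ: "f ` R = Q"
    proof (rule card_subset_eq[OF finite_Q])
      show "f ` R \<subseteq> Q" using f by (auto simp: placements_def)
      show "card (f ` R) = card Q"
        using f by (simp add: placements_def card_image cardR cardQ)
    qed
    have gv: "g (v i) = (i, 0)" if "i \<in> {1..m}" for i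
      using that v by (simp add: g_def m_def)
    have "pos f ` {1..n} = f ` R \<union> g ` Z"
      unfolding RZ[symmetric] image_Un using disjoint by (auto simp: pos_def image_iff)
    also have "g ` Z = {1..m} \<times> {0}"
      unfolding Z_def image_image using gv by (force simp: image_iff)
    also have "f ` R \<union> {1..m} \<times> {0} = {1..m} \<times> {..<k}"
      unfolding fRQ Q_def using k by (auto simp: Suc_le_eq)
    finally have img: "pos f ` {1..n} = {1..m} \<times> {..<k}" .
    then have bij: "bij_betw (pos f) {1..n} ({1..m} \<times> {..<k})"
      using inj by (simp add: bij_betw_def)
    show "bij_betw h ({1..n div k} \<times> {..<k}) {1..n}"
      unfolding h_def m_def[symmetric] using bij by (rule bij_betw_inv_into)
    have pos_h: "pos f (h x) = x" "h x \<in> {1..n}" if "x \<in> {1..m} \<times> {..<k}" for x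
      using that unfolding h_def img[symmetric] by (rule f_inv_into_f, rule inv_into_into)
    show "h (i, 0) = v i" if "i \<in> {1..n div k}" for i
    proof -
      have i: "i \<in> {1..m}" using that by (simp add: m_def)
      then have "v i \<in> Z" by (simp add: Z_def)
      then have "pos f (v i) = (i, 0)" using gv[OF i] disjoint by (auto simp: pos_def)
      moreover have "v i \<in> {1..n}" using \<open>v i \<in> Z\<close> ZV by blast
      ultimately show ?thesis unfolding h_def using inv_into_f_f[OF inj] by metis
    qed
    show "{h (i, j), h (i, Suc j)} \<in> E" if "i \<in> {1..n div k}" and j: "Suc j < k" for i j
    proof -
      have i: "i \<in> {1..m}" using that by (simp add: m_def)
      have 1: "pos f (h (i, j)) = (i, j)" "h (i, j) \<in> R \<union> Z"
        and 2: "pos f (h (i, Suc j)) = (i, Suc j)" "h (i, Suc j) \<in> R \<union> Z"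
        using pos_h[of "(i, j)"] pos_h[of "(i, Suc j)"] i j RZ by auto
      have "h (i, Suc j) \<in> R"
      proof (rule ccontr)
        assume "h (i, Suc j) \<notin> R"
        then have "pos f (h (i, Suc j)) = g (h (i, Suc j))" by (simp add: pos_def)
        then show False using 2 by (simp add: g_def)
      qed
      then have "arc f (h (i, j)) (h (i, Suc j))" using 1 2 by (simp add: arc_def)
      then show ?thesis using E unfolding edges_def by blast
    qed
  qed (use k in auto)
  let ?X = "all_edges n" and ?q = "4 * exp 2 / real n"
  have edges_X: "edges f \<subseteq> ?X" for f
  proof
    fix e assume "e \<in> edges f"
    then obtain a b where ab: "e = {a, b}" "arc f a b" by (auto simp: edges_def)
    then have "a \<in> {1..n}" "b \<in> {1..n}" unfolding RZ[symmetric] by (auto simp: arc_def)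
    moreover have "a \<noteq> b" using ab arc_irrefl by metis
    ultimately show "e \<in> ?X" using ab(1) unfolding all_edges_def by blast
  qed
  have spr: "spread ?q (fact (card R)) ?X placements edges"
    unfolding spread_def
  proof (intro allI impI)
    fix U
    have "real (card {f \<in> placements. U \<subseteq> edges f}) \<le> (2 * exp 2 / card R) ^ card U * fact (card R)"
      by (rule card_containing_placements_le[OF Rne])
    also have "\<dots> \<le> ?q ^ card U * fact (card R)"
    proof (intro mult_right_mono power_mono)
      have "2 * exp 2 / real (card R) \<le> 2 * exp 2 / (real n / 2)"
        using N n Npos by (intro divide_left_mono) auto
      then show "2 * exp 2 / real (card R) \<le> ?q" by simp
    qed auto
    finally show "real (card {f \<in> placements. U \<subseteq> edges f}) \<le> ?q ^ card U * fact (card R)" .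
  qed
  let ?p = "?q * b + real J * (64 * ?q)"
  have p0: "0 \<le> ?p" using b by simp
  have "miss_prob p ?X placements edges \<le> miss_prob ?p ?X placements edges"
    using p p0 finite_all_edges by (intro miss_prob_antimono) auto
  moreover have "miss_prob ?p ?X placements edges * card placements \<le>
      fact (card R) * ((1 + 1 / b) ^ d - 1 + (\<Sum>j\<in>{d<..card R}. (1 / 4) ^ j))"
  proof (rule spread_miss_prob)
    show "card R < 2 ^ J" using J by (simp add: cardR)
    show "?p \<le> 1" using p by simp
  qed (use finite_all_edges finite_placements edges_X card_edges_le spr n b in auto)
  \<comment> \<open>\<open>M = fact (card R)\<close> is exactly the number of placements and
    cancels.\<close>
  then have "miss_prob ?p ?X placements edges \<le>
      (1 + 1 / b) ^ d - 1 + (\<Sum>j\<in>{d<..card R}. (1 / 4) ^ j)"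
    by (simp add: card_placements mult.commute)
  moreover have "(\<Sum>j\<in>{d<..card R}. (1 / 4) ^ j) \<le> (1 / 4 :: real) ^ d"
    by (rule sum_quarter_powers_le)
  moreover have "1 \<le> measure_pmf.prob (Gnp n p) {E. has_path_system n k v E} +
      miss_prob p ?X placements edges"
  proof -
    have p01: "0 \<le> p" "p \<le> 1" using p p0 by auto
    have "1 = biased_sum p ?X (\<lambda>_. 1)" using finite_all_edges by (simp add: biased_sum_const)
    also have "\<dots> \<le> biased_sum p ?X (\<lambda>W. of_bool (W \<in> {E. has_path_system n k v E}) +
        of_bool (\<forall>f\<in>placements. \<not> edges f \<subseteq> W))"
      using paths by (intro biased_sum_mono p01) auto
    finally show ?thesis
      by (simp add: biased_sum_add miss_prob_def prob_Gnp[OF p01])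
  qed
  ultimately show ?thesis by linarith
qed

text \<open>With \<open>l = ln n\<close>, take \<open>b = l\<close> and stop halving at size about
  \<open>sqrt l\<close>. Then \<open>(1 + 1 / l) ^ d\<close> is close to 1 while
  \<open>(1 / 4) ^ d\<close> still vanishes.\<close>

lemma prob_path_system_ge_ln:
  assumes k: "0 < k" "k dvd n" and n: "1 \<le> ln (real n)"
    and v: "inj_on v {1..n div k}" "v ` {1..n div k} \<subseteq> {1..n}"
    and p: "1028 * exp 2 * ln (real n) / real n \<le> 1"
  shows "measure_pmf.prob (Gnp n (1028 * exp 2 * ln (real n) / real n)) {E. has_path_system n k v E}
    \<ge> 1 - (exp (1 / sqrt (ln (real n))) - 1 + (1 / 4) powr (sqrt (ln (real n)) - 1))"
proof (cases "k = 1")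
  case True
  then have "{E. has_path_system n k v E} = UNIV"
    using v has_path_system_one by auto
  then have "measure_pmf.prob (Gnp n (1028 * exp 2 * ln (real n) / real n))
      {E. has_path_system n k v E} = 1" by simp
  moreover have "1 \<le> exp (1 / sqrt (ln (real n)))" using n by simp
  moreover have "0 \<le> (1 / 4 :: real) powr (sqrt (ln (real n)) - 1)" by simp
  ultimately show ?thesis by linarith
next
  case False
  define l where "l = ln (real n)"
  define d where "d = nat \<lfloor>sqrt l\<rfloor>"
  \<comment> \<open>More than \<open>2 * l\<close> rounds suffice because
    \<open>exp (1 / 2) \<le> 2\<close> gives \<open>n = exp l < 2 ^ J\<close>.\<close>
  define J where "J = Suc (nat \<lceil>2 * l\<rceil>)"
  have l1: "1 \<le> l" using n by (simp add: l_def)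
  have n1: "1 \<le> n" using n by (cases n) auto
  have Jl: "2 * l < real J" "real J \<le> 2 * l + 2" using l1 unfolding J_def by linarith+
  have "exp (1 / 2 :: real) \<le> 2"
  proof -
    have "exp (1 / 2 :: real) \<le> 1 + 1 / 2 + (1 / 2)\<^sup>2" by (rule exp_bound) auto
    then show ?thesis by (simp add: power2_eq_square)
  qed
  have "real n = exp l" using n1 by (simp add: l_def)
  also have "\<dots> < exp (real J * (1 / 2))" using Jl by simp
  also have "\<dots> = exp (1 / 2) ^ J" by (rule exp_of_nat_mult)
  also have "\<dots> \<le> 2 ^ J" using \<open>exp (1 / 2) \<le> 2\<close> by (intro power_mono) auto
  finally have nJ: "n < 2 ^ J" by (metis of_nat_less_iff of_nat_numeral of_nat_power)
  \<comment> \<open>Since \<open>J \<le> 2 * l + 2 \<le> 4 * l\<close>, the factor is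
    \<open>1 + 64 * 4 = 257\<close>, and \<open>4 * 257 = 1028\<close>.\<close>
  have "l + real J * 64 \<le> 257 * l" using Jl l1 by linarith
  then have "(l + real J * 64) * (4 * exp 2 / n) \<le> 257 * l * (4 * exp 2 / n)"
    by (rule mult_right_mono) simp
  then have pl: "4 * exp 2 / n * l + real J * (64 * (4 * exp 2 / n)) \<le> 1028 * exp 2 * l / n"
    by (simp add: algebra_simps)
  have "measure_pmf.prob (Gnp n (1028 * exp 2 * l / n)) {E. has_path_system n k v E}
      \<ge> 1 - ((1 + 1 / l) ^ d - 1 + (1 / 4) ^ d)"
    using k False v n1 l1 nJ pl p[folded l_def] by (intro prob_path_system_ge) auto
  moreover have "(1 + 1 / l) ^ d \<le> exp (1 / sqrt l)"
  proof -
    have "(1 + 1 / l) ^ d \<le> exp (1 / l) ^ d"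
      using l1 by (intro power_mono exp_ge_add_one_self) auto
    also have "\<dots> = exp (real d * (1 / l))" by (rule exp_of_nat_mult[symmetric])
    also have "real d * (1 / l) \<le> sqrt l * (1 / l)"
      using l1 by (intro mult_right_mono) (auto simp: d_def)
    also have "sqrt l * (1 / l) = 1 / sqrt l"
      using l1 by (simp add: real_div_sqrt field_simps)
    finally show ?thesis by simp
  qed
  moreover have "(1 / 4 :: real) ^ d \<le> (1 / 4) powr (sqrt l - 1)"
  proof -
    have "(1 / 4 :: real) ^ d = (1 / 4) powr real d" by (simp add: powr_realpow)
    also have "\<dots> \<le> (1 / 4) powr (sqrt l - 1)"
      unfolding d_def by (intro powr_mono') linarith+
    finally show ?thesis .
  qed
  ultimately show ?thesis unfolding l_def by linarith
qed

theorem theorem1p3: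
  fixes D :: real
  assumes "D > 0"
  shows "\<exists>K::real. \<forall>(k::nat \<Rightarrow> nat) (v::nat \<Rightarrow> nat \<Rightarrow> nat).
    (\<forall>\<^sub>F n in sequentially. 0 < k n \<and> real (k n) < D * ln (real n) \<and> k n dvd n \<and>
        inj_on (v n) {1..n div k n} \<and> v n ` {1..n div k n} \<subseteq> {1..n})
    \<longrightarrow>
    ((\<lambda>n. measure_pmf.prob (Gnp n (K * ln (real n) / real n))
        {E. \<exists>P :: nat \<Rightarrow> nat list.
              (\<forall>i\<in>{1..n div k n}. is_path n E (P i) \<and> length (P i) = k n \<and>
                  (hd (P i) = v n i \<or> last (P i) = v n i)) \<and>
              (\<forall>i\<in>{1..n div k n}. \<forall>j\<in>{1..n div k n}. i \<noteq> j \<longrightarrow>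
                  set (P i) \<inter> set (P j) = {})})
     \<longlonglongrightarrow> 1)"
  unfolding has_path_system_def[symmetric]
proof (intro exI[of _ "1028 * exp 2"] allI impI)
  fix k :: "nat \<Rightarrow> nat" and v :: "nat \<Rightarrow> nat \<Rightarrow> nat"
  assume ev: "\<forall>\<^sub>F n in sequentially. 0 < k n \<and> real (k n) < D * ln (real n) \<and> k n dvd n \<and>
        inj_on (v n) {1..n div k n} \<and> v n ` {1..n div k n} \<subseteq> {1..n}"
  \<comment> \<open>For large \<open>n\<close> the logarithm is at least 1 and the density is a
    genuine probability, as the explicit bound requires.\<close>
  have "\<forall>\<^sub>F n in sequentially. 1 \<le> ln (real n)" by real_asymp
  moreover have "\<forall>\<^sub>F n in sequentially. 1028 * exp 2 * ln (real n) / real n \<le> 1" by real_asymp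
  ultimately have lower: "\<forall>\<^sub>F n in sequentially.
      1 - (exp (1 / sqrt (ln (real n))) - 1 + (1 / 4) powr (sqrt (ln (real n)) - 1)) \<le>
      measure_pmf.prob (Gnp n (1028 * exp 2 * ln (real n) / real n))
        {E. has_path_system n (k n) (v n) E}"
    using ev by eventually_elim (intro prob_path_system_ge_ln, auto)
  show "(\<lambda>n. measure_pmf.prob (Gnp n (1028 * exp 2 * ln (real n) / real n))
      {E. has_path_system n (k n) (v n) E}) \<longlonglongrightarrow> 1"
  \<comment> \<open>Both error terms vanish as \<open>ln n\<close> grows; the upper bound 1 holds
    for any probability.\<close>
  proof (rule tendsto_sandwich[OF lower, where h = "\<lambda>_. 1"])
    show "(\<lambda>n. 1 - (exp (1 / sqrt (ln (real n))) - 1 + (1 / 4) powr (sqrt (ln (real n)) - 1)))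
        \<longlonglongrightarrow> 1"
      by real_asymp
  qed (auto intro: always_eventually)
qed

end
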